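(* Let $S$ be a set of symbols with $|S| = 8$. In the erase-repetition game over $S$, Ann has a strategy to build an arbitrarily long nonrepetitive sequence: for every positive integer $n$, Ann has a strategy guaranteeing that, no matter how Ben plays, at some point of the game the current sequence has length at least $n$.
   Context: A repetition of size $h$ ($h \geq 1$) in a sequence is a block of consecutive terms of the form $x_1 \dots x_h x_1 \dots x_h$. A sequence is nonrepetitive if it contains no repetition of any size. The erase-repetition game over a symbol set $S$ is played by two players, Ann (moving first) and Ben, who alternately pick a symbol from $S$ and append it to the end of the current sequence (initially empty). Whenever the appended symbol creates a repetition, the repeated block (the second half $x_1\dots x_h$ of the repetition, i.e. the last $h$ terms) is immediately erased, and the next player continues extending the remaining sequence. Thus after each move the current sequence is nonrepetitive. *)

theory Defs
  imports "HOL-Library.Sublist"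
begin

definition repetition :: "nat \<Rightarrow> 'a list \<Rightarrow> bool" where
  "repetition h zs \<longleftrightarrow> h \<ge> 1 \<and> (\<exists>w. length w = h \<and> zs = w @ w)"

definition nonrepetitive :: "'a list \<Rightarrow> bool" where
  "nonrepetitive xs \<longleftrightarrow> \<not> (\<exists>h zs. repetition h zs \<and> sublist zs xs)"

definition ends_in_repetition :: "nat \<Rightarrow> 'a list \<Rightarrow> bool" where
  "ends_in_repetition h xs \<longleftrightarrow> (\<exists>zs. repetition h zs \<and> suffix zs xs)"

(* The choice of the least size is immaterial: starting from a nonrepetitive sequence, a new
   symbol creates repetitions of at most one size, see ends_in_repetition_unique below. *)
definition move :: "'a list \<Rightarrow> 'a \<Rightarrow> 'a list" where
  "move xs x =
     (let ys = xs @ [x] in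
      if \<exists>h. ends_in_repetition h ys
      then take (length ys - (LEAST h. ends_in_repetition h ys)) ys
      else ys)"

definition current_sequence :: "'a list \<Rightarrow> 'a list" where
  "current_sequence ms = foldl move [] ms"

(* A strategy sees the whole history of appended symbols, including the erased ones. *)
definition strategy :: "'a set \<Rightarrow> ('a list \<Rightarrow> 'a) \<Rightarrow> bool" where
  "strategy S \<sigma> \<longleftrightarrow> (\<forall>ms. set ms \<subseteq> S \<longrightarrow> \<sigma> ms \<in> S)"

(* p i is the symbol appended in the i-th move, counted from 0, so Ann makes the even ones.
   The symbols of the odd moves are unconstrained in S, hence cover everything Ben can do. *)
definition play_with :: "'a set \<Rightarrow> ('a list \<Rightarrow> 'a) \<Rightarrow> (nat \<Rightarrow> 'a) \<Rightarrow> bool" where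
  "play_with S \<sigma> p \<longleftrightarrow>
     (\<forall>i. p i \<in> S) \<and> (\<forall>i. even i \<longrightarrow> p i = \<sigma> (map p [0..<i]))"

lemma ends_in_repetition_iff:
  "ends_in_repetition h xs \<longleftrightarrow> h \<ge> 1 \<and> (\<exists>u w. length w = h \<and> xs = u @ w @ w)"
  unfolding ends_in_repetition_def repetition_def suffix_def by blast

lemma nonrepetitiveD: "nonrepetitive (u @ w @ w @ v) \<Longrightarrow> w = []"
proof (rule ccontr)
  assume a: "nonrepetitive (u @ w @ w @ v)" "w \<noteq> []"
  have "sublist (w @ w) (u @ w @ w @ v)"
    unfolding sublist_def by (metis append_assoc)
  moreover have "repetition (length w) (w @ w)"
    using a(2) unfolding repetition_def by (metis One_nat_def Suc_leI length_greater_0_conv)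
  ultimately show False
    using a(1) unfolding nonrepetitive_def by blast
qed

lemma nonrepetitive_sublist: "nonrepetitive xs \<Longrightarrow> sublist ys xs \<Longrightarrow> nonrepetitive ys"
  unfolding nonrepetitive_def using sublist_order.order_trans by blast

lemma nonrepetitive_snoc_iff:
  assumes "nonrepetitive xs"
  shows "nonrepetitive (xs @ [x]) \<longleftrightarrow> \<not> (\<exists>h. ends_in_repetition h (xs @ [x]))"
proof -
  have "sublist zs (xs @ [x]) \<longleftrightarrow> sublist zs xs \<or> suffix zs (xs @ [x])" for zs
    by (cases zs rule: rev_cases) (auto simp: sublist_snoc)
  then show ?thesis
    using assms unfolding nonrepetitive_def ends_in_repetition_def by blast
qed

lemma ends_in_repetition_not_less:
  assumes nr: "nonrepetitive xs"
    and h: "ends_in_repetition h (xs @ [x])" and k: "ends_in_repetition k (xs @ [x])"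
  shows "\<not> h < k"
proof
  assume "h < k"
  obtain u w where w: "h \<ge> 1" "length w = h" "xs @ [x] = u @ w @ w"
    using h unfolding ends_in_repetition_iff by blast
  obtain v y where y: "length y = k" "xs @ [x] = v @ y @ y"
    using k unfolding ends_in_repetition_iff by blast
  have no_sq: "a = []" if "xs @ [x] = b @ a @ a @ c" "c \<noteq> []" for a b c
  proof -
    have "xs = b @ a @ a @ butlast c"
      using that by (metis append_assoc butlast_append butlast_snoc append_is_Nil_conv)
    with nr show ?thesis using nonrepetitiveD by metis
  qed
  have suf: "suffix w (xs @ [x])" "suffix (w @ w) (xs @ [x])"
    using w(3) unfolding suffix_def by (metis append_assoc)+
  have sufy: "suffix y (xs @ [x])"
    using y(2) unfolding suffix_def by (metis append_assoc)
  have sw: "suffix w y"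
    using suffix_length_suffix[OF suf(1) sufy] w y \<open>h < k\<close> by simp
  show False
  proof (cases "2 * h \<le> k")
    case True
    have "suffix (w @ w) y"
      using suffix_length_suffix[OF suf(2) sufy] w y True by simp
    then obtain b where "y = b @ w @ w" by (auto simp: suffix_def)
    then have "xs @ [x] = (v @ b) @ w @ w @ y" using y by simp
    moreover have "y \<noteq> []" using y \<open>h < k\<close> by auto
    ultimately have "w = []" using no_sq by blast
    then show False using w by simp
  next
    case False
    obtain a where a: "y = a @ w" using sw by (auto simp: suffix_def)
    have la: "length a = k - h" using a w y by simp
    have eq: "v @ y @ a = u @ w" using w(3) y(2) a by auto
    have "suffix a w"
    proof (rule suffix_length_suffix)
      show "suffix a (u @ w)"
        using eq unfolding suffix_def by (metis append_assoc)
      show "suffix w (u @ w)"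
        by (simp add: suffix_def)
      show "length a \<le> length w"
        using la w False by simp
    qed
    then obtain b where b: "w = b @ a" by (auto simp: suffix_def)
    have "xs @ [x] = (v @ a @ b) @ a @ a @ w" using y(2) a b by simp
    moreover have "w \<noteq> []" using w by auto
    ultimately have "a = []" using no_sq by blast
    then show False using la \<open>h < k\<close> by simp
  qed
qed

lemma ends_in_repetition_unique:
  assumes "nonrepetitive xs"
    and "ends_in_repetition h (xs @ [x])" and "ends_in_repetition k (xs @ [x])"
  shows "h = k"
  using assms ends_in_repetition_not_less[of xs] by (meson linorder_neqE_nat)

lemma nonrepetitive_move:
  assumes "nonrepetitive xs"
  shows "nonrepetitive (move xs x)"
proof (cases "\<exists>h. ends_in_repetition h (xs @ [x])")
  case True
  define h where "h = (LEAST h. ends_in_repetition h (xs @ [x]))"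
  have "ends_in_repetition h (xs @ [x])"
    unfolding h_def using True by (rule LeastI_ex)
  then have "h \<ge> 1" unfolding ends_in_repetition_iff by blast
  then have "move xs x = take (length (xs @ [x]) - h) xs"
    using True by (auto simp: move_def Let_def h_def[symmetric])
  then show ?thesis
    using assms nonrepetitive_sublist sublist_take by metis
next
  case False
  then show ?thesis
    using nonrepetitive_snoc_iff[OF assms, of x] by (auto simp: move_def)
qed

lemma nonrepetitive_current_sequence: "nonrepetitive (current_sequence ms)"
proof (induction ms rule: rev_induct)
  case Nil
  show ?case by (auto simp: current_sequence_def nonrepetitive_def repetition_def)
next
  case (snoc m ms)
  then show ?case by (simp add: current_sequence_def nonrepetitive_move)
qed

end

theory Submission imports Complex_Main Defs begin

text \<open>
  Ann always avoids the last three symbols, so she has at least five options, and no move of hers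
  erases fewer than four symbols. Moreover, after each of her moves the last symbol differs from
  the three symbols before it, so Ben can only erase nothing, one symbol (which amounts to
  passing), or at least four symbols.

  Suppose that Ben can keep the sequence shorter than \<open>n\<close> during \<open>k\<close> rounds. His replies being
  fixed, the list of all appended symbols without Ben's passes still determines Ann's choices, so
  the \<open>5 ^ k\<close> ways Ann can play give as many lists, each of length at most \<open>2 * k\<close>. But a move
  that turns the sequence into \<open>f\<close> is undone uniquely once the number of erased symbols is known,
  whence at most \<open>\<lambda> ^ L * x ^ length f\<close> lists of length \<open>L\<close> lead to \<open>f\<close>, provided
  \<open>\<lambda> * x \<ge> 1 + x ^ 4 / (1 - x)\<close>. For \<open>x = 3 / 5\<close> and \<open>\<lambda> = 331 / 150\<close> we have \<open>\<lambda> ^ 2 < 5\<close>,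
  a contradiction for large \<open>k\<close>.
\<close>

section \<open>Sizes of the repetitions that a single move can erase\<close>

lemma move_cases:
  obtains (append) "\<And>h. \<not> ends_in_repetition h (s @ [a])" "move s a = s @ [a]"
  | (erase) u w where "w \<noteq> []" "ends_in_repetition (length w) (s @ [a])"
      "s @ [a] = u @ w @ w" "move s a = u @ w"
      "\<And>h. ends_in_repetition h (s @ [a]) \<Longrightarrow> length w \<le> h"
proof (cases "\<exists>h. ends_in_repetition h (s @ [a])")
  case False
  then show ?thesis using append by (simp add: move_def)
next
  case True
  define h where "h = (LEAST h. ends_in_repetition h (s @ [a]))"
  have h: "ends_in_repetition h (s @ [a])"
    unfolding h_def using True by (rule LeastI_ex)
  obtain u w where w: "h \<ge> 1" "length w = h" "s @ [a] = u @ w @ w"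
    using h unfolding ends_in_repetition_iff by blast
  have "move s a = take (length (s @ [a]) - h) (s @ [a])"
    unfolding move_def Let_def h_def using True by simp
  also have "\<dots> = u @ w" unfolding w(3) using w(2) by simp
  finally have "move s a = u @ w" .
  moreover have "\<And>k. ends_in_repetition k (s @ [a]) \<Longrightarrow> h \<le> k"
    unfolding h_def by (rule Least_le)
  ultimately show ?thesis using w h by (intro erase[of w u]) auto
qed

lemma set_move_subset: "set (move s a) \<subseteq> insert a (set s)"
proof (cases rule: move_cases[of s a])
  case (erase u w)
  then have "set (move s a) \<subseteq> set (s @ [a])" by auto
  then show ?thesis by auto
qed simp

definition last3 :: "'a list \<Rightarrow> 'a list" where
  "last3 s = drop (length s - 3) s"

lemma card_last3: "card (set (last3 s)) \<le> 3"
  using card_length[of "last3 s"] by (simp add: last3_def)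

lemma last3_append: "length v \<ge> 3 \<Longrightarrow> last3 (u @ v) = last3 v"
  by (simp add: last3_def)

lemma in_last3: "length v \<le> 2 \<Longrightarrow> a \<in> set (last3 (u @ a # v))"
  by (auto simp: last3_def)

definition big_move :: "'a list \<Rightarrow> 'a \<Rightarrow> bool" where
  "big_move s a \<longleftrightarrow> (\<forall>h. ends_in_repetition h (s @ [a]) \<longrightarrow> h \<ge> 4)"

text \<open>In a repetition with halves of size \<open>h\<close> that ends in \<open>a\<close>, the
  first half ends in \<open>a\<close> too, \<open>h\<close> places earlier. For \<open>h\<close> at
  most 3 that place lies among the last three symbols of \<open>s\<close>.\<close>

lemma big_move_fresh:
  assumes "a \<notin> set (last3 s)"
  shows "big_move s a"
  unfolding big_move_def
proof (intro allI impI)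
  fix h assume "ends_in_repetition h (s @ [a])"
  then obtain u w where w: "h \<ge> 1" "length w = h" "s @ [a] = u @ w @ w"
    unfolding ends_in_repetition_iff by blast
  then obtain v where v: "w = v @ [a]"
    by (cases w rule: rev_cases) auto
  have "s = (u @ v) @ a # v" using w(3) v by simp
  then have "\<not> length v \<le> 2" using in_last3 assms by metis
  then show "h \<ge> 4" using w(2) v by simp
qed

text \<open>An erased block has size at least 4, so the surviving first half ends in the same three
  symbols followed by \<open>a\<close> as before the erasure.\<close>

lemma move_fresh:
  assumes "a \<notin> set (last3 s)"
  obtains t where "move s a = t @ [a]" "a \<notin> set (last3 t)"
proof (cases rule: move_cases[of s a])
  case append
  then show ?thesis using that assms by blast
next
  case (erase u w)
  then obtain v where v: "w = v @ [a]"
    by (cases w rule: rev_cases) auto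
  have "length w \<ge> 4"
    using big_move_fresh[OF assms] erase(2) unfolding big_move_def by blast
  then have len: "length v \<ge> 3" using v by simp
  have "s = (u @ v @ [a]) @ v" using erase(3) v by simp
  then have "last3 s = last3 v" using last3_append[OF len] by metis
  then have "a \<notin> set (last3 (u @ v))"
    using last3_append[OF len, of u] assms by simp
  moreover have "move s a = (u @ v) @ [a]" using erase(4) v by simp
  ultimately show ?thesis using that by blast
qed

text \<open>Repeating \<open>a\<close> erases only the new symbol, which is a pass. For
  \<open>b\<close> other than \<open>a\<close>, both halves of a repetition end in \<open>a\<close>,
  \<open>b\<close>; if its size were at most 3, the earlier \<open>a\<close> would be among the last
  three symbols of \<open>t\<close>.\<close>

lemma move_after_fresh:
  assumes "a \<notin> set (last3 t)"
  shows "move (t @ [a]) b = t @ [a] \<or> big_move (t @ [a]) b"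
proof (cases "b = a")
  case True
  have rep: "ends_in_repetition 1 ((t @ [a]) @ [b])"
    unfolding ends_in_repetition_iff using True by (intro conjI exI[of _ t] exI[of _ "[a]"]) auto
  show ?thesis
  proof (cases rule: move_cases[of "t @ [a]" b])
    case append
    then show ?thesis using rep by blast
  next
    case (erase u w)
    then have "length w = 1" using rep by (metis One_nat_def Suc_leI le_antisym length_greater_0_conv)
    then obtain c where "w = [c]" by (auto simp: length_Suc_conv)
    then show ?thesis using erase by simp
  qed
next
  case False
  have "big_move (t @ [a]) b"
    unfolding big_move_def
  proof (intro allI impI)
    fix h assume "ends_in_repetition h ((t @ [a]) @ [b])"
    then obtain u w where w: "h \<ge> 1" "length w = h" "t @ [a, b] = u @ w @ w"
      unfolding ends_in_repetition_iff by auto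
    then obtain w' where w': "w = w' @ [b]"
      by (cases w rule: rev_cases) auto
    then have ta: "t @ [a] = u @ w' @ b # w'" using w(3) by simp
    then obtain v where v: "w' = v @ [a]"
      using False by (cases w' rule: rev_cases) auto
    have "t = (u @ v) @ a # b # v" using ta v by simp
    then have "\<not> length (b # v) \<le> 2" using in_last3 assms by metis
    then show "h \<ge> 4" using w(2) w' v by simp
  qed
  then show ?thesis ..
qed

fun big_moves :: "'a list \<Rightarrow> 'a list \<Rightarrow> bool" where
  "big_moves s [] \<longleftrightarrow> True"
| "big_moves s (a # u) \<longleftrightarrow> big_move s a \<and> big_moves (move s a) u"

lemma big_moves_append:
  "big_moves s (u @ v) \<longleftrightarrow> big_moves s u \<and> big_moves (foldl move s u) v"
  by (induction u arbitrary: s) auto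

subsection \<open>Counting the lists of moves leading to a given sequence\<close>

text \<open>Since passes are left out of the lists, whose turn it is cannot be read off them; the
  count ignores turns.\<close>

definition runs_to :: "nat \<Rightarrow> 'a list \<Rightarrow> 'a list set" where
  "runs_to L f = {u. length u = L \<and> big_moves [] u \<and> foldl move [] u = f}"

text \<open>The erased block copies the end of \<open>f\<close>: if its size is \<open>h\<close>,
  then \<open>s\<close> is \<open>f\<close> followed by the last \<open>h\<close> symbols of
  \<open>f\<close> except the final one. So \<open>f\<close> and \<open>h\<close> determine the
  move.\<close>

lemma big_move_predecessor:
  assumes "big_move s a" "move s a = f"
  shows "f \<noteq> [] \<and> a = last f \<and>
    (s = butlast f \<or> (\<exists>h\<in>{4..length f}. s = f @ butlast (drop (length f - h) f)))"
proof (cases rule: move_cases[of s a])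
  case append
  then show ?thesis using assms by auto
next
  case (erase u w)
  then obtain v where v: "w = v @ [a]"
    by (cases w rule: rev_cases) auto
  have "length w \<ge> 4"
    using assms(1) erase(2) unfolding big_move_def by blast
  moreover have f: "f = u @ w" using erase(4) assms(2) by simp
  moreover have "s = f @ butlast (drop (length f - length w) f)"
    using erase(3) v unfolding f by simp
  ultimately show ?thesis
    using v by (intro conjI disjI2 bexI[of _ "length w"]) auto
qed

lemma runs_to_Suc_subset:
  "runs_to (Suc L) f \<subseteq>
    (\<lambda>u. u @ [last f]) ` ((if f = [] then {} else runs_to L (butlast f)) \<union>
      (\<Union>h\<in>{4..length f}. runs_to L (f @ butlast (drop (length f - h) f))))"
proof
  fix v assume v: "v \<in> runs_to (Suc L) f"
  then obtain u a where ua: "v = u @ [a]" "length u = L"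
    by (auto simp: runs_to_def length_Suc_conv_rev)
  then have "big_moves [] u" "big_move (foldl move [] u) a" "move (foldl move [] u) a = f"
    using v by (auto simp: runs_to_def big_moves_append)
  with big_move_predecessor[of "foldl move [] u" a f] ua
  show "v \<in> (\<lambda>u. u @ [last f]) ` ((if f = [] then {} else runs_to L (butlast f)) \<union>
      (\<Union>h\<in>{4..length f}. runs_to L (f @ butlast (drop (length f - h) f))))"
    by (auto simp: runs_to_def intro!: imageI)
qed

lemma geometric_tail_le: "(\<Sum>h\<in>{4..m}. (3/5::real) ^ (h - 1)) \<le> 27/50"
proof (cases "m \<ge> 4")
  case True
  \<comment> \<open>The right side is the exact value (x^3 - x^m) / (1 - x) at x = 3/5, which makes
    the induction go through.\<close>
  have "(\<Sum>h\<in>{4..m}. (3/5::real) ^ (h - 1)) \<le> 27/50 - (5/2) * (3/5) ^ m"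
    using True by (induction m rule: dec_induct) (auto simp: eval_nat_numeral)
  also have "\<dots> \<le> 27/50" by simp
  finally show ?thesis .
qed simp

lemma card_runs_to:
  "finite (runs_to L f) \<and> real (card (runs_to L f)) \<le> (331/150) ^ L * (3/5) ^ length f"
proof (induction L arbitrary: f)
  case 0
  have "runs_to 0 f \<subseteq> {[]}" "f \<noteq> [] \<Longrightarrow> runs_to 0 f = {}"
    by (auto simp: runs_to_def)
  then show ?case
    using card_mono[of "{[]}" "runs_to 0 f"] finite_subset[of "runs_to 0 f" "{[]}"]
    by (cases "f = []") auto
next
  case (Suc L)
  let ?x = "3/5 :: real"
  let ?l = "331/150 :: real"
  let ?pre = "\<lambda>h. f @ butlast (drop (length f - h) f)"
  let ?A = "if f = [] then {} else runs_to L (butlast f)"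
  let ?B = "\<Union>h\<in>{4..length f}. runs_to L (?pre h)"
  have fin: "finite (?A \<union> ?B)" using Suc by auto
  have A: "real (card ?A) \<le> ?l ^ L * (?x ^ length f * (5/3))"
  proof (cases f rule: rev_cases)
    case (snoc g a)
    then show ?thesis using Suc[of g] by simp
  qed simp
  have "real (card ?B) \<le> (\<Sum>h\<in>{4..length f}. real (card (runs_to L (?pre h))))"
    using card_UN_le[of "{4..length f}" "\<lambda>h. runs_to L (?pre h)"]
    by (metis finite_atLeastAtMost of_nat_le_iff of_nat_sum)
  also have "\<dots> \<le> (\<Sum>h\<in>{4..length f}. ?l ^ L * ?x ^ length f * ?x ^ (h - 1))"
  proof (rule sum_mono)
    fix h assume "h \<in> {4..length f}"
    then have "length (?pre h) = length f + (h - 1)" by auto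
    then show "real (card (runs_to L (?pre h))) \<le> ?l ^ L * ?x ^ length f * ?x ^ (h - 1)"
      using Suc[of "?pre h"] by (simp add: power_add mult.assoc)
  qed
  also have "\<dots> \<le> ?l ^ L * ?x ^ length f * (27/50)"
    unfolding sum_distrib_left[symmetric]
    by (intro mult_left_mono geometric_tail_le) auto
  finally have B: "real (card ?B) \<le> ?l ^ L * ?x ^ length f * (27/50)" .
  have "card (runs_to (Suc L) f) \<le> card ((\<lambda>u. u @ [last f]) ` (?A \<union> ?B))"
    using runs_to_Suc_subset fin by (intro card_mono finite_imageI)
  also have "\<dots> \<le> card (?A \<union> ?B)" using fin by (rule card_image_le)
  also have "\<dots> \<le> card ?A + card ?B" by (rule card_Un_le)
  finally have "real (card (runs_to (Suc L) f)) \<le> real (card ?A) + real (card ?B)"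
    by (simp only: of_nat_add[symmetric] of_nat_le_iff)
  \<comment> \<open>This fixes the growth rate: 5/3 + 27/50 = 331/150.\<close>
  also have "\<dots> \<le> ?l ^ Suc L * ?x ^ length f" using A B by simp
  finally show ?case
    using finite_subset[OF runs_to_Suc_subset finite_imageI[OF fin]] by blast
qed

subsection \<open>The game restricted to a fixed number of rounds\<close>

text \<open>The horizon \<open>k\<close> makes the game finite, so the failure of this recursion
  gives Ben a reply to each choice of Ann. Length is tested only when a round begins or play
  stops.\<close>

primrec ann_wins :: "'a set \<Rightarrow> nat \<Rightarrow> nat \<Rightarrow> 'a list \<Rightarrow> bool" where
  "ann_wins S n 0 s \<longleftrightarrow> n \<le> length s"
| "ann_wins S n (Suc k) s \<longleftrightarrow>
     n \<le> length s \<or> (\<exists>a\<in>S. \<forall>b\<in>S. ann_wins S n k (move (move s a) b))"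

text \<open>Ann merely stays in won positions; avoiding the last three symbols matters only for
  proving that the start is won.\<close>

lemma ann_wins_strategy:
  assumes "ann_wins S n k []" "S \<noteq> {}"
  shows "\<exists>\<sigma>. strategy S \<sigma> \<and> (\<forall>p. play_with S \<sigma> p \<longrightarrow>
    (\<exists>m. n \<le> length (current_sequence (map p [0..<m]))))"
proof -
  \<comment> \<open>At Ann's turn, \<open>length ms div 2\<close> counts the finished rounds; the
    \<open>Suc\<close> accounts for the present one.\<close>
  define good where "good ms a \<longleftrightarrow>
      (\<forall>b\<in>S. ann_wins S n (k - Suc (length ms div 2)) (move (move (current_sequence ms) a) b))"
    for ms a
  define \<sigma> where "\<sigma> ms = (if \<exists>a\<in>S. good ms a then SOME a. a \<in> S \<and> good ms a else SOME a. a \<in> S)"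
    for ms
  have \<sigma>: "\<sigma> ms \<in> S" "\<exists>a\<in>S. good ms a \<Longrightarrow> good ms (\<sigma> ms)" for ms
    using someI_ex[of "\<lambda>a. a \<in> S \<and> good ms a"] some_in_eq[of S] assms(2)
    unfolding \<sigma>_def by (auto split: if_splits)
  have "\<exists>m. n \<le> length (current_sequence (map p [0..<m]))" if p: "play_with S \<sigma> p" for p
  proof (rule ccontr)
    assume "\<not> ?thesis"
    then have short: "\<not> n \<le> length (current_sequence (map p [0..<m]))" for m by blast
    have "ann_wins S n (k - i) (current_sequence (map p [0..<2 * i]))" if "i \<le> k" for i
      using that
    proof (induction i)
      case 0
      then show ?case using assms(1) by (simp add: current_sequence_def)
    next
      case (Suc i)
      let ?ms = "map p [0..<2 * i]"
      have k: "k - i = Suc (k - Suc i)" using Suc.prems by simp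
      have "\<exists>a\<in>S. good ?ms a"
        using Suc short[of "2 * i"] unfolding good_def k by auto
      then have "good ?ms (p (2 * i))"
        using \<sigma>(2) p unfolding play_with_def by simp
      moreover have "p (Suc (2 * i)) \<in> S" using p unfolding play_with_def by blast
      ultimately show ?case
        unfolding good_def by (simp add: current_sequence_def)
    qed
    from this[of k] short[of "2 * k"] show False by simp
  qed
  then show ?thesis using \<sigma>(1) unfolding strategy_def by blast
qed

lemma not_ann_wins_many_runs:
  assumes "card S = 8" "\<not> ann_wins S n k s" "set s \<subseteq> S"
  shows "\<exists>P. finite P \<and> card P = 5 ^ k \<and> (\<forall>u\<in>P. big_moves s u \<and> length u \<le> 2 * k \<and>
    length (foldl move s u) < n \<and> set (foldl move s u) \<subseteq> S)"
  using assms(2,3)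
proof (induction k arbitrary: s)
  case 0
  then show ?case by (intro exI[of _ "{[]}"]) auto
next
  case (Suc k)
  have "card S - card (set (last3 s)) \<le> card (S - set (last3 s))"
    by (rule diff_card_le_card_Diff) simp
  then have "5 \<le> card (S - set (last3 s))"
    using card_last3[of s] assms(1) by linarith
  then obtain C where C: "C \<subseteq> S - set (last3 s)" "card C = 5" "finite C"
    by (rule obtain_subset_with_card_n)
  \<comment> \<open>\<open>e\<close> is Ben's reply, or empty if that reply is a pass.\<close>
  have "\<exists>e P. finite P \<and> card P = 5 ^ k \<and> (\<forall>u\<in>P. big_moves s (a # e @ u) \<and>
      length (a # e @ u) \<le> 2 * Suc k \<and> length (foldl move s (a # e @ u)) < n \<and>
      set (foldl move s (a # e @ u)) \<subseteq> S)" if a: "a \<in> C" for a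
  proof -
    have aS: "a \<in> S" "a \<notin> set (last3 s)" using C a by auto
    obtain b where b: "b \<in> S" "\<not> ann_wins S n k (move (move s a) b)"
      using Suc.prems(1) aS by auto
    have "set (move (move s a) b) \<subseteq> S"
      using set_move_subset[of s a] set_move_subset[of "move s a" b] Suc.prems(2) aS b by blast
    from Suc.IH[OF b(2) this] obtain P where P: "finite P" "card P = 5 ^ k"
      "\<forall>u\<in>P. big_moves (move (move s a) b) u \<and> length u \<le> 2 * k \<and>
        length (foldl move (move (move s a) b) u) < n \<and>
        set (foldl move (move (move s a) b) u) \<subseteq> S"
      by blast
    obtain t where t: "move s a = t @ [a]" "a \<notin> set (last3 t)"
      using move_fresh[OF aS(2)] .
    from move_after_fresh[OF t(2), of b] show ?thesis
    proof
      assume "move (t @ [a]) b = t @ [a]"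
      then show ?thesis
        using P t(1) big_move_fresh[OF aS(2)] by (intro exI[of _ "[]"] exI[of _ P]) auto
    next
      assume "big_move (t @ [a]) b"
      then show ?thesis
        using P t(1) big_move_fresh[OF aS(2)] by (intro exI[of _ "[b]"] exI[of _ P]) auto
    qed
  qed
  then obtain e P where P: "\<And>a. a \<in> C \<Longrightarrow> finite (P a)" "\<And>a. a \<in> C \<Longrightarrow> card (P a) = 5 ^ k"
    "\<And>a. a \<in> C \<Longrightarrow> \<forall>u\<in>P a. big_moves s (a # e a @ u) \<and> length (a # e a @ u) \<le> 2 * Suc k \<and>
      length (foldl move s (a # e a @ u)) < n \<and> set (foldl move s (a # e a @ u)) \<subseteq> S"
    by metis
  let ?Q = "\<lambda>a. (\<lambda>u. a # e a @ u) ` P a"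
  \<comment> \<open>The first symbol of a list reveals \<open>a\<close>, hence \<open>e a\<close>,
    so no two choices of Ann yield the same list.\<close>
  have "card (\<Union>a\<in>C. ?Q a) = (\<Sum>a\<in>C. card (?Q a))"
    using C(3) P(1) by (intro card_UN_disjoint) auto
  also have "\<dots> = (\<Sum>a\<in>C. 5 ^ k)"
    using P(2) by (intro sum.cong refl) (subst card_image, auto simp: inj_on_def)
  finally have "card (\<Union>a\<in>C. ?Q a) = 5 ^ Suc k" using C(2) by simp
  then show ?case
    using C(3) P(1,3) by (intro exI[of _ "\<Union>a\<in>C. ?Q a"]) auto
qed

lemma ex_ann_wins:
  assumes "card S = 8"
  shows "\<exists>k. ann_wins S n k []"
proof (rule ccontr)
  assume "\<not> ?thesis"
  then have lose: "\<not> ann_wins S n k []" for k by blast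
  have finS: "finite S" using assms by (metis card.infinite zero_neq_numeral)
  let ?F = "{f. set f \<subseteq> S \<and> length f \<le> n}"
  let ?l = "331/150 :: real"
  have finF: "finite ?F" using finS by (rule finite_lists_length_le)
  have bound: "5 ^ k \<le> (2 * real k + 1) * real (card ?F) * ?l ^ (2 * k)" for k
  proof -
    obtain P where P: "card P = 5 ^ k" "\<forall>u\<in>P. big_moves [] u \<and> length u \<le> 2 * k \<and>
        length (foldl move [] u) < n \<and> set (foldl move [] u) \<subseteq> S"
      using not_ann_wins_many_runs[OF assms lose[of k]] by auto
    have "P \<subseteq> (\<Union>(L, f)\<in>{..2 * k} \<times> ?F. runs_to L f)"
      using P(2) by (auto simp: runs_to_def)
    then have "card P \<le> card (\<Union>(L, f)\<in>{..2 * k} \<times> ?F. runs_to L f)"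
      using finF card_runs_to by (intro card_mono) auto
    also have "\<dots> \<le> (\<Sum>(L, f)\<in>{..2 * k} \<times> ?F. card (runs_to L f))"
      using card_UN_le[of "{..2 * k} \<times> ?F" "\<lambda>(L, f). runs_to L f"] finF
      by (simp add: case_prod_unfold)
    finally have "real (card P) \<le> real (\<Sum>(L, f)\<in>{..2 * k} \<times> ?F. card (runs_to L f))"
      by (rule of_nat_mono)
    also have "\<dots> = (\<Sum>(L, f)\<in>{..2 * k} \<times> ?F. real (card (runs_to L f)))"
      by (simp add: case_prod_unfold)
    \<comment> \<open>Each pair contributes at most the largest power, as 331/150 exceeds 1 and 3/5
      does not.\<close>
    also have "\<dots> \<le> (\<Sum>y\<in>{..2 * k} \<times> ?F. ?l ^ (2 * k))"
    proof (rule sum_mono)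
      fix y assume "y \<in> {..2 * k} \<times> ?F"
      then obtain L f where y: "y = (L, f)" "L \<le> 2 * k" by auto
      then have "?l ^ L * (3/5) ^ length f \<le> ?l ^ (2 * k) * 1"
        by (intro mult_mono power_increasing power_le_one) auto
      then show "(case y of (L, f) \<Rightarrow> real (card (runs_to L f))) \<le> ?l ^ (2 * k)"
        using card_runs_to[of L f] y(1) by simp
    qed
    finally show ?thesis using P(1) by (simp add: card_cartesian_product algebra_simps)
  qed
  \<comment> \<open>This is (331/150)^2 / 5, which is below 1, so its powers outweigh the linear
    factor from the choice of the length \<open>L\<close>.\<close>
  let ?q = "109561/112500 :: real"
  have "(\<lambda>k. 2 * real (card ?F) * (real k * ?q ^ k) + real (card ?F) * ?q ^ k)
      \<longlonglongrightarrow> 2 * real (card ?F) * 0 + real (card ?F) * 0"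
    by (intro tendsto_intros powser_times_n_limit_0 LIMSEQ_realpow_zero) auto
  then have "\<forall>\<^sub>F k in sequentially.
      2 * real (card ?F) * (real k * ?q ^ k) + real (card ?F) * ?q ^ k < 1"
    by (rule order_tendstoD) simp
  then obtain k where k: "2 * real (card ?F) * (real k * ?q ^ k) + real (card ?F) * ?q ^ k < 1"
    by (auto simp: eventually_sequentially)
  have "?l ^ (2 * k) = (?q * 5) ^ k" by (simp add: power_mult power2_eq_square)
  then have "(2 * real k + 1) * real (card ?F) * ?l ^ (2 * k) =
      (2 * real (card ?F) * (real k * ?q ^ k) + real (card ?F) * ?q ^ k) * 5 ^ k"
    by (simp only: power_mult_distrib) (simp add: algebra_simps)
  also have "\<dots> < 1 * 5 ^ k" using k by (intro mult_strict_right_mono) auto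
  finally show False using bound[of k] by simp
qed

theorem theorem1:
  fixes S :: "'a set" and n :: nat
  assumes "card S = 8" and "n \<ge> 1"
  shows "\<exists>\<sigma>. strategy S \<sigma> \<and>
           (\<forall>p. play_with S \<sigma> p \<longrightarrow>
              (\<exists>m. nonrepetitive (current_sequence (map p [0..<m])) \<and>
                   length (current_sequence (map p [0..<m])) \<ge> n))"
proof -
  have "S \<noteq> {}" using assms(1) by auto
  moreover obtain k where "ann_wins S n k []" using ex_ann_wins[OF assms(1)] by blast
  ultimately show ?thesis
    using ann_wins_strategy nonrepetitive_current_sequence by metis
qed

end
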